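(* Let $D_x, D_y$ be non-periodic first-derivative SBP operators on a two-dimensional tensor-product grid with diagonal mass (norm) matrix $M$ and boundary operators $R^TBN_xR$, $R^TBN_yR$. Let $g,\lambda$ be real constants and let $\boldsymbol{b}$ be a time-independent grid vector (bathymetry). Consider the semi-discretization (a system of ordinary differential equations in time $t$ for the grid vectors $\boldsymbol{h},\boldsymbol{u},\boldsymbol{v},\boldsymbol{w},\boldsymbol{\eta}$, with $\boldsymbol{h}$ componentwise positive) of the two-dimensional hyperbolic approximation of the Serre--Green--Naghdi equations with weakly enforced reflecting boundary conditions given by $$\boldsymbol{h}_t + \boldsymbol{u}D_x \boldsymbol{h} + \boldsymbol{h}D_x\boldsymbol{u} + \boldsymbol{v}D_y \boldsymbol{h} + \boldsymbol{h}D_y\boldsymbol{v} - M^{-1}R^TBN_xR(\boldsymbol{h}\boldsymbol{u}) - M^{-1}R^TBN_yR(\boldsymbol{h}\boldsymbol{v}) = \boldsymbol{0},$$ $$\begin{aligned} &\boldsymbol{h}\boldsymbol{u}_t + gD_x(\boldsymbol{h}(\boldsymbol{h}+\boldsymbol{b})) - g(\boldsymbol{h}+\boldsymbol{b})D_x \boldsymbol{h} + \tfrac12\boldsymbol{h}D_x(\boldsymbol{u}^2) - \tfrac12\boldsymbol{u}^2 D_x \boldsymbol{h} + \tfrac12\boldsymbol{u}D_x(\boldsymbol{h}\boldsymbol{u}) - \tfrac12\boldsymbol{h}\boldsymbol{u}D_x \boldsymbol{u}\\ &\quad + \tfrac12 D_y(\boldsymbol{h}\boldsymbol{u}\boldsymbol{v})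 - \tfrac12 \boldsymbol{u}\boldsymbol{v}D_y\boldsymbol{h} + \tfrac12 \boldsymbol{h}\boldsymbol{v}D_y \boldsymbol{u} - \tfrac12 \boldsymbol{h}\boldsymbol{u}D_y \boldsymbol{v}\\ &\quad + \tfrac{\lambda}{6}\tfrac{\boldsymbol{\eta}^{2}}{\boldsymbol{h}^{2}}D_x \boldsymbol{h} + \tfrac{\lambda}{3}D_x \boldsymbol{\eta} - \tfrac{\lambda}{3}\tfrac{\boldsymbol{\eta}}{\boldsymbol{h}}D_x \boldsymbol{\eta} - \tfrac{\lambda}{6}D_x\left(\tfrac{\boldsymbol{\eta}^{2}}{\boldsymbol{h}}\right) + \tfrac{\lambda}{2}\left(1-\tfrac{\boldsymbol{\eta}}{\boldsymbol{h}}\right)D_x \boldsymbol{b} = \boldsymbol{0}, \end{aligned}$$ $$\begin{aligned} &\boldsymbol{h}\boldsymbol{v}_t + gD_y(\boldsymbol{h}(\boldsymbol{h}+\boldsymbol{b})) - g(\boldsymbol{h}+\boldsymbol{b})D_y\boldsymbol{h} + \tfrac12\boldsymbol{h}D_y(\boldsymbol{v}^2) - \tfrac12\boldsymbol{v}^2 D_y \boldsymbol{h} + \tfrac12\boldsymbol{v}D_y(\boldsymbol{h}\boldsymbol{v}) - \tfrac12\boldsymbol{h}\boldsymbol{v}D_y \boldsymbol{v}\\ &\quad + \tfrac12 D_x(\boldsymbol{h}\boldsymbol{u}\boldsymbol{v}) - \tfrac12 \boldsymbol{u}\boldsymbol{v}D_x \boldsymbol{h} + \tfrac12 \boldsymbol{h}\boldsymbol{u}D_x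 \boldsymbol{v} - \tfrac12 \boldsymbol{h}\boldsymbol{v}D_x \boldsymbol{u}\\ &\quad + \tfrac{\lambda}{6}\tfrac{\boldsymbol{\eta}^{2}}{\boldsymbol{h}^{2}}D_y \boldsymbol{h} + \tfrac{\lambda}{3}D_y \boldsymbol{\eta} - \tfrac{\lambda}{3}\tfrac{\boldsymbol{\eta}}{\boldsymbol{h}}D_y \boldsymbol{\eta} - \tfrac{\lambda}{6}D_y\left(\tfrac{\boldsymbol{\eta}^{2}}{\boldsymbol{h}}\right) + \tfrac{\lambda}{2}\left(1-\tfrac{\boldsymbol{\eta}}{\boldsymbol{h}}\right)D_y \boldsymbol{b} = \boldsymbol{0}, \end{aligned}$$ $$\begin{aligned} &\boldsymbol{h}\boldsymbol{w}_t + \tfrac12D_x(\boldsymbol{h}\boldsymbol{u}\boldsymbol{w}) + \tfrac12\boldsymbol{h}\boldsymbol{u}D_x \boldsymbol{w} - \tfrac12\boldsymbol{u}\boldsymbol{w}D_x \boldsymbol{h} - \tfrac12\boldsymbol{h}\boldsymbol{w}D_x \boldsymbol{u}\\ &\quad + \tfrac12D_y(\boldsymbol{h}\boldsymbol{v}\boldsymbol{w}) + \tfrac12\boldsymbol{h}\boldsymbol{v}D_y \boldsymbol{w} - \tfrac12\boldsymbol{v}\boldsymbol{w}D_y \boldsymbol{h} - \tfrac12\boldsymbol{h}\boldsymbol{w}D_y \boldsymbol{v} = \lambda\left(1-\tfrac{\boldsymbol{\eta}}{\boldsymbol{h}}\right), \end{aligned}$$ $$\boldsymbol{\eta}_t +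 \boldsymbol{u}D_x \boldsymbol{\eta} + \boldsymbol{v}D_y \boldsymbol{\eta} + \tfrac32\boldsymbol{u}D_x \boldsymbol{b} + \tfrac32\boldsymbol{v}D_y \boldsymbol{b} = \boldsymbol{w}.$$ Then, along every solution of this system: 1. the total water mass $\boldsymbol{1}^T M \boldsymbol{h}$ is conserved, i.e. $\frac{d}{dt}\left(\boldsymbol{1}^T M \boldsymbol{h}\right) = 0$; 2. the total energy $\boldsymbol{1}^T M \boldsymbol{E}$ is conserved, i.e. $\frac{d}{dt}\left(\boldsymbol{1}^T M \boldsymbol{E}\right)=0$, where $$\boldsymbol{E} = \boldsymbol{h}\left(\frac{\boldsymbol{u}^2+\boldsymbol{v}^2}{2} + \frac{1}{6}\boldsymbol{w}^2 + \frac{g}{2}(\boldsymbol{h}+2\boldsymbol{b}) + \frac{\lambda}{6}\left(\frac{\boldsymbol{\eta}}{\boldsymbol{h}}-1\right)^2\right).$$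
   Context: Grid vectors: the domain is discretized by a tensor-product grid with $\mathcal{N}_x\times \mathcal{N}_y$ nodes including the boundary nodes; a grid vector is an element of $\mathbb{R}^{\mathcal{N}_x\mathcal{N}_y}$ of nodal values. All products, quotients, powers and other nonlinear operations of grid vectors are evaluated componentwise (e.g. $\boldsymbol{u}D_x\boldsymbol{h}$ is the componentwise product of $\boldsymbol{u}$ with the vector $D_x\boldsymbol{h}$); scalars such as $1$ in $1-\boldsymbol{\eta}/\boldsymbol{h}$ stand for constant vectors, and $\boldsymbol{1}=(1,\dots,1)^T$. The subscript $t$ denotes the time derivative. All matrices are constant in time. One-dimensional (non-periodic) SBP operator: a first-derivative summation-by-parts (SBP) operator consists of a grid $x_{\min}=\boldsymbol{x}_1\le\dots\le\boldsymbol{x}_{\mathcal N}=x_{\max}$, a consistent first-derivative matrix $D$ (a matrix with at least $D\boldsymbol{1}=\boldsymbol{0}$) and a symmetric positive-definite matrix $M$ (mass or norm matrix) such that $MD+D^TM=\boldsymbol{e}_R\boldsymbol{e}_R^T-\boldsymbol{e}_L\boldsymbol{e}_L^T$, where $\boldsymbol{e}_L=(1,0,\dots,0)^T$ and $\boldsymbol{e}_R=(0,\dots,0,1)^T$. Two-dimensional operators: these are obtained from one-dimensional ones $(D_{1,x},M_x)$ and $(D_{1,y},M_y)$ with diagonal $M_x,M_y$ by tensor products, $D_x=D_{1,x}\otimes I$, $D_y=I\otimes D_{1,y}$, $M=M_x\otimes M_y$ (diagonal with positive entries). The matrix $R$ restricts a grid vector to the nodes on the boundary (edge by edge), $B$ is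 the diagonal boundary mass matrix (quadrature weights of $M_y$ on the left/right edges and of $M_x$ on the bottom/top edges), and $N_x,N_y$ are the diagonal matrices that multiply by the $x$- and $y$-component of the outer unit normal. Thus $$R^TBN_xR=(\boldsymbol{e}_R\boldsymbol{e}_R^T-\boldsymbol{e}_L\boldsymbol{e}_L^T)\otimes M_y,\qquad R^TBN_yR=M_x\otimes(\boldsymbol{e}_R\boldsymbol{e}_R^T-\boldsymbol{e}_L\boldsymbol{e}_L^T),$$ where $\boldsymbol{e}_L,\boldsymbol{e}_R$ have the size appropriate to the respective direction, and the SBP properties $MD_x+D_x^TM=R^TBN_xR$ and $MD_y+D_y^TM=R^TBN_yR$ hold. Meaning of the variables: $h$ is the water height above the bathymetry $b$, $(u,v)$ is the velocity, $\eta,w$ are auxiliary variables, $g$ is the gravitational acceleration and $\lambda$ the relaxation parameter. The terms with $M^{-1}R^TBN_xR$ and $M^{-1}R^TBN_yR$ are simultaneous approximation terms weakly imposing zero normal velocity at the boundary. *)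

theory Defs
  imports "HOL-Analysis.Analysis"
begin

text \<open>
  A one-dimensional grid with N nodes is indexed by an arbitrary finite linearly ordered type
  (equivalently 1 < ... < N), so that \<open>Min UNIV\<close> and \<open>Max UNIV\<close> are its first and last node.
  A grid vector on the tensor-product grid has type \<open>real ^ ('nx \<times> 'ny)\<close>.

  In HOL-Analysis, \<open>*\<close>, \<open>^\<close> and \<open>1\<close> on vectors are the componentwise product, the componentwise
  power and the all-ones vector. Consequently \<open>*\<close> between grid vectors is what the mathematics
  means, but on matrices one has to use \<open>**\<close>, \<open>*v\<close> and \<open>mat 1\<close>.
\<close>

definition cdiv :: "real ^ 'n \<Rightarrow> real ^ 'n \<Rightarrow> real ^ 'n"  (infixl "\<oslash>" 70)
  where "x \<oslash> y = (\<chi> i. x $ i / y $ i)"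


subsection \<open>One-dimensional SBP operators\<close>

definition e_L :: "real ^ 'n::{finite,linorder}"
  where "e_L = axis (Min UNIV) 1"

definition e_R :: "real ^ 'n::{finite,linorder}"
  where "e_R = axis (Max UNIV) 1"

definition outer :: "real ^ 'm \<Rightarrow> real ^ 'n \<Rightarrow> real ^ 'n ^ 'm"
  where "outer x y = (\<chi> i j. x $ i * y $ j)"

definition diagonal :: "real ^ 'n ^ 'n \<Rightarrow> bool"
  where "diagonal A \<longleftrightarrow> (\<forall>i j. i \<noteq> j \<longrightarrow> A $ i $ j = 0)"

definition sym_pos_def :: "real ^ 'n ^ 'n \<Rightarrow> bool"
  where "sym_pos_def A \<longleftrightarrow> transpose A = A \<and> (\<forall>x. x \<noteq> 0 \<longrightarrow> x \<bullet> (A *v x) > 0)"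

definition SBP_operator ::
  "real \<Rightarrow> real \<Rightarrow> real ^ 'n::{finite,linorder} \<Rightarrow> real ^ 'n::{finite,linorder} ^ 'n::{finite,linorder} \<Rightarrow>
   real ^ 'n::{finite,linorder} ^ 'n::{finite,linorder} \<Rightarrow> bool"
  where "SBP_operator xmin xmax x D M \<longleftrightarrow>
     x $ Min UNIV = xmin \<and> x $ Max UNIV = xmax \<and> mono (\<lambda>i. x $ i) \<and>
     D *v 1 = 0 \<and>
     sym_pos_def M \<and>
     M ** D + transpose D ** M = outer e_R e_R - outer e_L e_L"


subsection \<open>Two-dimensional tensor-product operators\<close>

definition kron :: "real ^ 'n ^ 'n \<Rightarrow> real ^ 'm ^ 'm \<Rightarrow> real ^ ('n \<times> 'm) ^ ('n \<times> 'm)"  (infixr "\<otimes>\<^sub>K" 75)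
  where "A \<otimes>\<^sub>K B = (\<chi> p q. A $ fst p $ fst q * B $ snd p $ snd q)"

text \<open>
  Boundary nodes are listed edge by edge, so each corner of the domain occurs once for each of the
  two edges it belongs to.
\<close>

datatype ('nx, 'ny) bnode = Left_edge 'ny | Right_edge 'ny | Bottom_edge 'nx | Top_edge 'nx

instance bnode :: (finite, finite) finite
proof
  have "x \<in> range Left_edge \<union> range Right_edge \<union> range Bottom_edge \<union> range Top_edge"
    for x :: "('a, 'b) bnode"
    by (cases x) simp_all
  then have "(UNIV :: ('a, 'b) bnode set) \<subseteq>
      range Left_edge \<union> range Right_edge \<union> range Bottom_edge \<union> range Top_edge"
    by (rule subsetI)
  then show "finite (UNIV :: ('a, 'b) bnode set)"
    by (rule finite_subset) simp
qed

fun bnode_pos :: "('nx::{finite,linorder}, 'ny::{finite,linorder}) bnode \<Rightarrow> 'nx \<times> 'ny" where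
  "bnode_pos (Left_edge j) = (Min UNIV, j)"
| "bnode_pos (Right_edge j) = (Max UNIV, j)"
| "bnode_pos (Bottom_edge i) = (i, Min UNIV)"
| "bnode_pos (Top_edge i) = (i, Max UNIV)"

fun bnode_weight :: "real ^ 'nx ^ 'nx \<Rightarrow> real ^ 'ny ^ 'ny \<Rightarrow> ('nx, 'ny) bnode \<Rightarrow> real" where
  "bnode_weight Mx My (Left_edge j) = My $ j $ j"
| "bnode_weight Mx My (Right_edge j) = My $ j $ j"
| "bnode_weight Mx My (Bottom_edge i) = Mx $ i $ i"
| "bnode_weight Mx My (Top_edge i) = Mx $ i $ i"

fun normal_x :: "('nx, 'ny) bnode \<Rightarrow> real" where
  "normal_x (Left_edge j) = -1"
| "normal_x (Right_edge j) = 1"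
| "normal_x (Bottom_edge i) = 0"
| "normal_x (Top_edge i) = 0"

fun normal_y :: "('nx, 'ny) bnode \<Rightarrow> real" where
  "normal_y (Left_edge j) = 0"
| "normal_y (Right_edge j) = 0"
| "normal_y (Bottom_edge i) = -1"
| "normal_y (Top_edge i) = 1"

definition diag_of :: "('n \<Rightarrow> real) \<Rightarrow> real ^ 'n ^ 'n"
  where "diag_of d = (\<chi> i j. if i = j then d i else 0)"

definition restr_mat ::
  "real ^ ('nx::{finite,linorder} \<times> 'ny::{finite,linorder}) ^ ('nx, 'ny) bnode"
  where "restr_mat = (\<chi> k p. if p = bnode_pos k then 1 else 0)"

definition bmass_mat ::
  "real ^ 'nx ^ 'nx \<Rightarrow> real ^ 'ny ^ 'ny \<Rightarrow> real ^ ('nx::finite, 'ny::finite) bnode ^ ('nx, 'ny) bnode"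
  where "bmass_mat Mx My = diag_of (bnode_weight Mx My)"

definition normal_x_mat :: "real ^ ('nx::finite, 'ny::finite) bnode ^ ('nx, 'ny) bnode"
  where "normal_x_mat = diag_of normal_x"

definition normal_y_mat :: "real ^ ('nx::finite, 'ny::finite) bnode ^ ('nx, 'ny) bnode"
  where "normal_y_mat = diag_of normal_y"


subsection \<open>The semi-discretization\<close>

text \<open>
  The system at one instant of time; \<open>ht\<close>, ..., \<open>etat\<close> are the values of the time derivatives.
  \<open>BNx\<close> and \<open>BNy\<close> stand for the boundary operators R^T B N_x R and R^T B N_y R.
\<close>

definition sgn_mass_eq where
  "sgn_mass_eq Dx Dy (M :: real ^ 'n ^ 'n) BNx BNy h u v ht \<longleftrightarrow>
     ht + u * (Dx *v h) + h * (Dx *v u) + v * (Dy *v h) + h * (Dy *v v)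
     - matrix_inv M *v (BNx *v (h * u)) - matrix_inv M *v (BNy *v (h * v)) = 0"

definition sgn_x_momentum_eq where
  "sgn_x_momentum_eq Dx Dy g lambda b (h :: real ^ 'n) u v eta ut \<longleftrightarrow>
     h * ut
     + g *\<^sub>R (Dx *v (h * (h + b))) - g *\<^sub>R ((h + b) * (Dx *v h))
     + (1/2) *\<^sub>R (h * (Dx *v u^2)) - (1/2) *\<^sub>R (u^2 * (Dx *v h))
     + (1/2) *\<^sub>R (u * (Dx *v (h * u))) - (1/2) *\<^sub>R (h * u * (Dx *v u))
     + (1/2) *\<^sub>R (Dy *v (h * u * v)) - (1/2) *\<^sub>R (u * v * (Dy *v h))
     + (1/2) *\<^sub>R (h * v * (Dy *v u)) - (1/2) *\<^sub>R (h * u * (Dy *v v))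
     + (lambda/6) *\<^sub>R ((eta^2 \<oslash> h^2) * (Dx *v h)) + (lambda/3) *\<^sub>R (Dx *v eta)
     - (lambda/3) *\<^sub>R ((eta \<oslash> h) * (Dx *v eta)) - (lambda/6) *\<^sub>R (Dx *v (eta^2 \<oslash> h))
     + (lambda/2) *\<^sub>R ((1 - eta \<oslash> h) * (Dx *v b)) = 0"

definition sgn_y_momentum_eq where
  "sgn_y_momentum_eq Dx Dy g lambda b (h :: real ^ 'n) u v eta vt \<longleftrightarrow>
     h * vt
     + g *\<^sub>R (Dy *v (h * (h + b))) - g *\<^sub>R ((h + b) * (Dy *v h))
     + (1/2) *\<^sub>R (h * (Dy *v v^2)) - (1/2) *\<^sub>R (v^2 * (Dy *v h))
     + (1/2) *\<^sub>R (v * (Dy *v (h * v))) - (1/2) *\<^sub>R (h * v * (Dy *v v))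
     + (1/2) *\<^sub>R (Dx *v (h * u * v)) - (1/2) *\<^sub>R (u * v * (Dx *v h))
     + (1/2) *\<^sub>R (h * u * (Dx *v v)) - (1/2) *\<^sub>R (h * v * (Dx *v u))
     + (lambda/6) *\<^sub>R ((eta^2 \<oslash> h^2) * (Dy *v h)) + (lambda/3) *\<^sub>R (Dy *v eta)
     - (lambda/3) *\<^sub>R ((eta \<oslash> h) * (Dy *v eta)) - (lambda/6) *\<^sub>R (Dy *v (eta^2 \<oslash> h))
     + (lambda/2) *\<^sub>R ((1 - eta \<oslash> h) * (Dy *v b)) = 0"

definition sgn_w_eq where
  "sgn_w_eq Dx Dy lambda (h :: real ^ 'n) u v w eta wt \<longleftrightarrow>
     h * wt
     + (1/2) *\<^sub>R (Dx *v (h * u * w)) + (1/2) *\<^sub>R (h * u * (Dx *v w))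
     - (1/2) *\<^sub>R (u * w * (Dx *v h)) - (1/2) *\<^sub>R (h * w * (Dx *v u))
     + (1/2) *\<^sub>R (Dy *v (h * v * w)) + (1/2) *\<^sub>R (h * v * (Dy *v w))
     - (1/2) *\<^sub>R (v * w * (Dy *v h)) - (1/2) *\<^sub>R (h * w * (Dy *v v))
     = lambda *\<^sub>R (1 - eta \<oslash> h)"

definition sgn_eta_eq where
  "sgn_eta_eq Dx Dy b (u :: real ^ 'n) v w eta etat \<longleftrightarrow>
     etat + u * (Dx *v eta) + v * (Dy *v eta)
     + (3/2) *\<^sub>R (u * (Dx *v b)) + (3/2) *\<^sub>R (v * (Dy *v b)) = w"

text \<open>
  Solutions on a time interval \<open>T\<close>, which may be open, closed or unbounded; at an endpoint
  belonging to \<open>T\<close> the time derivatives are one-sided.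
\<close>

definition sgn_solution ::
  "real ^ 'n ^ 'n \<Rightarrow> real ^ 'n ^ 'n \<Rightarrow> real ^ 'n ^ 'n \<Rightarrow> real ^ 'n ^ 'n \<Rightarrow> real ^ 'n ^ 'n \<Rightarrow>
   real \<Rightarrow> real \<Rightarrow> real ^ 'n \<Rightarrow> real set \<Rightarrow>
   (real \<Rightarrow> real ^ 'n) \<Rightarrow> (real \<Rightarrow> real ^ 'n) \<Rightarrow> (real \<Rightarrow> real ^ 'n) \<Rightarrow> (real \<Rightarrow> real ^ 'n) \<Rightarrow>
   (real \<Rightarrow> real ^ 'n) \<Rightarrow> bool"
  where "sgn_solution Dx Dy M BNx BNy g lambda b T h u v w eta \<longleftrightarrow>
    (\<forall>t\<in>T. (\<forall>i. h t $ i > 0) \<and>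
      (\<exists>ht ut vt wt etat.
         (h has_vector_derivative ht) (at t within T) \<and>
         (u has_vector_derivative ut) (at t within T) \<and>
         (v has_vector_derivative vt) (at t within T) \<and>
         (w has_vector_derivative wt) (at t within T) \<and>
         (eta has_vector_derivative etat) (at t within T) \<and>
         sgn_mass_eq Dx Dy M BNx BNy (h t) (u t) (v t) ht \<and>
         sgn_x_momentum_eq Dx Dy g lambda b (h t) (u t) (v t) (eta t) ut \<and>
         sgn_y_momentum_eq Dx Dy g lambda b (h t) (u t) (v t) (eta t) vt \<and>
         sgn_w_eq Dx Dy lambda (h t) (u t) (v t) (w t) (eta t) wt \<and>
         sgn_eta_eq Dx Dy b (u t) (v t) (w t) (eta t) etat))"

definition sgn_energy where
  "sgn_energy g lambda b (h :: real ^ 'n) u v w eta =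
     h * ((1/2) *\<^sub>R (u^2 + v^2) + (1/6) *\<^sub>R w^2 + (g/2) *\<^sub>R (h + 2 * b)
          + (lambda/6) *\<^sub>R (eta \<oslash> h - 1)^2)"

end

theory Submission
  imports Defs
begin

text \<open>
  Let \<open>p\<close> be the diagonal of \<open>M\<^sup>-\<^sup>1 R\<^sup>T B N R\<close>. For a diagonal norm, the SBP property says that the local
  quantity \<open>a D c + c D a - p a c\<close> has zero discrete integral for all grid vectors \<open>a\<close>, \<open>c\<close>. The split
  forms and boundary terms of the scheme are such that, at every node, the rates of change of mass
  and energy are linear combinations of such quantities; the pairs \<open>(a, c)\<close> in the \<open>x\<close>-direction are
  \<open>(h(h+b), u)\<close>, \<open>(hu, u\<^sup>2)\<close>, \<open>(huv, v)\<close>, \<open>(huw, w)\<close>, \<open>(h, u)\<close> and \<open>(\<eta>\<^sup>2/h, u)\<close>. No chain rule is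
  needed for \<open>D\<close>, which enters only through these pairs.
\<close>

section \<open>Diagonal matrices and Kronecker products\<close>

lemma diag_of_nth: "diag_of d $ i $ j = (if i = j then d i else 0)"
  by (simp add: diag_of_def)

lemma diag_of_mult_vec: "(diag_of d *v z) $ i = d i * z $ i"
  by (simp add: diag_of_def matrix_vector_mult_def mult_delta_left)

lemma diag_of_mult_diag_of: "diag_of c ** diag_of d = diag_of (\<lambda>i. c i * d i)"
  by (simp add: vec_eq_iff diag_of_nth matrix_matrix_mult_def mult_delta_left)

lemma diag_of_mult_nth: "(diag_of d ** A) $ i $ j = d i * A $ i $ j"
  by (simp add: diag_of_nth matrix_matrix_mult_def mult_delta_left)

lemma diag_of_one: "diag_of (\<lambda>_. 1) = mat 1"
  by (simp add: diag_of_def mat_def)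

text \<open>\<open>matrix_inv\<close> is defined by choice. The explicit inverse \<open>?E\<close>
  shows that the chosen matrix really is a two-sided inverse, and associativity then forces it to
  equal \<open>?E\<close>.\<close>

lemma matrix_inv_diag_of:
  assumes "\<And>i. d i \<noteq> 0"
  shows "matrix_inv (diag_of d) = diag_of (\<lambda>i. inverse (d i))"
proof -
  let ?D = "diag_of d" and ?E = "diag_of (\<lambda>i. inverse (d i))"
  have E: "?D ** ?E = mat 1" "?E ** ?D = mat 1"
    using assms by (simp_all add: diag_of_mult_diag_of diag_of_one)
  have "?D ** matrix_inv ?D = mat 1 \<and> matrix_inv ?D ** ?D = mat 1"
    unfolding matrix_inv_def by (rule someI[of _ ?E]) (use E in simp)
  then have "?E = ?E ** (?D ** matrix_inv ?D)"
    by simp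
  also have "\<dots> = matrix_inv ?D"
    by (simp add: matrix_mul_assoc E)
  finally show ?thesis
    by simp
qed

lemma diagonal_eq_diag_of: "diagonal A \<Longrightarrow> A = diag_of (\<lambda>i. A $ i $ i)"
  by (simp add: diagonal_def vec_eq_iff diag_of_def)

lemma sym_pos_def_diag_pos:
  assumes "sym_pos_def A"
  shows "A $ i $ i > 0"
proof -
  have "axis i (1::real) \<bullet> (A *v axis i 1) > 0"
    using assms by (simp add: sym_pos_def_def axis_eq_0_iff)
  then show ?thesis
    by (simp add: inner_axis' matrix_vector_mult_basis column_def)
qed

lemma kron_nth: "(A \<otimes>\<^sub>K B) $ p $ q = A $ fst p $ fst q * B $ snd p $ snd q"
  by (simp add: kron_def)

lemma kron_diag_of: "diag_of c \<otimes>\<^sub>K diag_of d = diag_of (\<lambda>p. c (fst p) * d (snd p))"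
  by (auto simp: vec_eq_iff kron_nth diag_of_nth)

text \<open>Mixed-product property: the sum over index pairs is a double sum, which factors because
  each summand splits into a part for either direction.\<close>

lemma kron_mult: "(A \<otimes>\<^sub>K B) ** (C \<otimes>\<^sub>K D) = (A ** C) \<otimes>\<^sub>K (B ** D)"
proof (simp add: vec_eq_iff, intro allI)
  fix a b a' b'
  have "((A \<otimes>\<^sub>K B) ** (C \<otimes>\<^sub>K D)) $ (a, b) $ (a', b') =
      (\<Sum>q\<in>UNIV. (A $ a $ fst q * C $ fst q $ a') * (B $ b $ snd q * D $ snd q $ b'))"
    by (simp add: matrix_matrix_mult_def kron_nth mult_ac)
  also have "\<dots> = (\<Sum>i\<in>UNIV. \<Sum>j\<in>UNIV. (A $ a $ i * C $ i $ a') * (B $ b $ j * D $ j $ b'))"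
    by (simp add: sum.cartesian_product case_prod_unfold flip: UNIV_Times_UNIV)
  also have "\<dots> = ((A ** C) \<otimes>\<^sub>K (B ** D)) $ (a, b) $ (a', b')"
    by (simp add: kron_nth matrix_matrix_mult_def sum_product)
  finally show "((A \<otimes>\<^sub>K B) ** (C \<otimes>\<^sub>K D)) $ (a, b) $ (a', b') =
      ((A ** C) \<otimes>\<^sub>K (B ** D)) $ (a, b) $ (a', b')" .
qed

lemma transpose_kron: "transpose (A \<otimes>\<^sub>K B) = transpose A \<otimes>\<^sub>K transpose B"
  by (simp add: vec_eq_iff transpose_def kron_nth)

lemma kron_add_left: "(A + B) \<otimes>\<^sub>K C = A \<otimes>\<^sub>K C + B \<otimes>\<^sub>K C"
  by (simp add: vec_eq_iff kron_nth distrib_right)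

lemma kron_add_right: "A \<otimes>\<^sub>K (B + C) = A \<otimes>\<^sub>K B + A \<otimes>\<^sub>K C"
  by (simp add: vec_eq_iff kron_nth distrib_left)


section \<open>Two-dimensional SBP property\<close>

lemma sum_bnode:
  fixes f :: "('nx::finite, 'ny::finite) bnode \<Rightarrow> real"
  shows "(\<Sum>k\<in>UNIV. f k) =
     (\<Sum>j\<in>UNIV. f (Left_edge j)) + (\<Sum>j\<in>UNIV. f (Right_edge j)) +
     (\<Sum>i\<in>UNIV. f (Bottom_edge i)) + (\<Sum>i\<in>UNIV. f (Top_edge i))"
proof -
  have U: "(UNIV :: ('nx, 'ny) bnode set) =
      ((range Left_edge \<union> range Right_edge) \<union> range Bottom_edge) \<union> range Top_edge"
  proof (intro set_eqI iffI UNIV_I)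
    fix k :: "('nx, 'ny) bnode"
    show "k \<in> ((range Left_edge \<union> range Right_edge) \<union> range Bottom_edge) \<union> range Top_edge"
      by (cases k) simp_all
  qed
  have inj: "inj (Left_edge :: 'ny \<Rightarrow> ('nx, 'ny) bnode)" "inj (Right_edge :: 'ny \<Rightarrow> ('nx, 'ny) bnode)"
    "inj (Bottom_edge :: 'nx \<Rightarrow> ('nx, 'ny) bnode)" "inj (Top_edge :: 'nx \<Rightarrow> ('nx, 'ny) bnode)"
    by (simp_all add: inj_def)
  have "sum f UNIV = sum f (range Left_edge) + sum f (range Right_edge) +
      sum f (range Bottom_edge) + sum f (range Top_edge)"
    unfolding U by (subst sum.union_disjoint, (auto)[3])+ simp
  then show ?thesis
    by (simp add: sum.reindex inj)
qed

text \<open>Each row of \<open>restr_mat\<close> has a single 1, so no boundary node couples two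
  distinct grid nodes. A grid node collects the weights of all boundary nodes located there, which
  at a corner come from two edges.\<close>

lemma boundary_operator_nth:
  fixes c d :: "('nx::{finite,linorder}, 'ny::{finite,linorder}) bnode \<Rightarrow> real"
  shows "(transpose restr_mat ** diag_of c ** diag_of d ** restr_mat) $ p $ q =
    (if p = q then \<Sum>k\<in>UNIV. if bnode_pos k = p then c k * d k else 0 else 0)"
proof -
  have "(transpose restr_mat ** diag_of c ** diag_of d ** restr_mat) $ p $ q =
      (\<Sum>k\<in>UNIV. (if p = bnode_pos k then 1 else 0) * (c k * d k) * (if q = bnode_pos k then 1 else 0))"
    unfolding matrix_mul_assoc[symmetric]
    by (subst matrix_matrix_mult_def) (simp add: diag_of_mult_nth transpose_def restr_mat_def mult.assoc)
  also have "\<dots> = (if p = q then \<Sum>k\<in>UNIV. if bnode_pos k = p then c k * d k else 0 else 0)"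
    by (cases "p = q") (auto intro!: sum.cong sum.neutral)
  finally show ?thesis .
qed

text \<open>The diagonal of the one-dimensional boundary matrix. As a difference of two indicators
  it is also right on a one-node grid, where the two ends cancel.\<close>

definition end_sign :: "'n::{finite,linorder} \<Rightarrow> real"
  where "end_sign i = (if i = Max UNIV then 1 else 0) - (if i = Min UNIV then 1 else 0)"

lemma outer_end_points: "outer e_R e_R - outer e_L e_L = diag_of end_sign"
  by (auto simp: vec_eq_iff outer_def e_R_def e_L_def axis_def diag_of_nth end_sign_def)

text \<open>The normal component vanishes on the bottom and top edges; the left and right edges each
  have exactly one node at height \<open>b\<close>.\<close>

lemma sum_bnode_x:
  "(\<Sum>k\<in>UNIV. if bnode_pos k = (a, b) then bnode_weight Mx My k * normal_x k else 0) =
     end_sign a * My $ b $ b"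
  unfolding sum_bnode
  by (cases "a = Max UNIV"; cases "a = Min UNIV") (simp_all add: end_sign_def eq_commute[of _ a] cong: if_cong)

lemma sum_bnode_y:
  "(\<Sum>k\<in>UNIV. if bnode_pos k = (a, b) then bnode_weight Mx My k * normal_y k else 0) =
     Mx $ a $ a * end_sign b"
  unfolding sum_bnode
  by (cases "b = Max UNIV"; cases "b = Min UNIV") (simp_all add: end_sign_def eq_commute[of _ b] cong: if_cong)

lemma boundary_operator_x:
  "transpose restr_mat ** bmass_mat Mx My ** normal_x_mat ** restr_mat =
     diag_of (\<lambda>p. end_sign (fst p) * My $ snd p $ snd p)"
  by (simp add: vec_eq_iff bmass_mat_def normal_x_mat_def boundary_operator_nth sum_bnode_x diag_of_nth)

lemma boundary_operator_y:
  "transpose restr_mat ** bmass_mat Mx My ** normal_y_mat ** restr_mat =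
     diag_of (\<lambda>p. Mx $ fst p $ fst p * end_sign (snd p))"
  by (simp add: vec_eq_iff bmass_mat_def normal_y_mat_def boundary_operator_nth sum_bnode_y diag_of_nth)

text \<open>The identity factor leaves \<open>K\<close> unchanged in both products, so the
  one-dimensional SBP identity is simply tensored with \<open>K\<close>.\<close>

lemma sbp_kron_x:
  assumes "N ** D + transpose D ** N = C"
  shows "(N \<otimes>\<^sub>K K) ** (D \<otimes>\<^sub>K mat 1) + transpose (D \<otimes>\<^sub>K mat 1) ** (N \<otimes>\<^sub>K K) = C \<otimes>\<^sub>K K"
  by (simp add: kron_mult transpose_kron flip: kron_add_left assms)

lemma sbp_kron_y:
  assumes "N ** D + transpose D ** N = C"
  shows "(K \<otimes>\<^sub>K N) ** (mat 1 \<otimes>\<^sub>K D) + transpose (mat 1 \<otimes>\<^sub>K D) ** (K \<otimes>\<^sub>K N) = K \<otimes>\<^sub>K C"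
  by (simp add: kron_mult transpose_kron flip: kron_add_right assms)


section \<open>Conservation for diagonal-norm SBP operators\<close>

definition product_defect :: "real ^ 'n ^ 'n \<Rightarrow> ('n \<Rightarrow> real) \<Rightarrow> real ^ 'n \<Rightarrow> real ^ 'n \<Rightarrow> 'n \<Rightarrow> real"
  where "product_defect D p a c i = a $ i * (D *v c) $ i + c $ i * (D *v a) $ i - p i * a $ i * c $ i"

text \<open>The SBP identity is tested with \<open>a\<close> and \<open>c\<close>, and
  \<open>transpose D\<close> is moved onto \<open>a\<close>. Diagonality turns both sides into
  weighted nodal sums.\<close>

lemma sum_product_defect:
  fixes D :: "real ^ 'n ^ 'n"
  assumes sbp: "diag_of m ** D + transpose D ** diag_of m = diag_of \<beta>" and m: "\<And>i. m i \<noteq> 0"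
  shows "(\<Sum>i\<in>UNIV. m i * product_defect D (\<lambda>i. \<beta> i / m i) a c i) = 0"
proof -
  have "a \<bullet> ((diag_of m ** D + transpose D ** diag_of m) *v c) =
      a \<bullet> (diag_of m *v (D *v c)) + (D *v a) \<bullet> (diag_of m *v c)"
    using dot_lmul_matrix[of a "transpose D" "diag_of m *v c"]
    by (simp only: matrix_vector_mult_add_rdistrib inner_add_right vector_transpose_matrix
        flip: matrix_vector_mul_assoc)
  also have "\<dots> = (\<Sum>i\<in>UNIV. m i * (a $ i * (D *v c) $ i + c $ i * (D *v a) $ i))"
    by (simp add: inner_vec_def diag_of_mult_vec algebra_simps sum.distrib)
  finally have "(\<Sum>i\<in>UNIV. m i * (a $ i * (D *v c) $ i + c $ i * (D *v a) $ i)) =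
      (\<Sum>i\<in>UNIV. \<beta> i * a $ i * c $ i)"
    by (simp add: sbp) (simp add: inner_vec_def diag_of_mult_vec mult_ac)
  then show ?thesis
    using m by (simp add: product_defect_def right_diff_distrib sum_subtractf mult.assoc)
qed

section \<open>Nodal rates of change of mass and energy\<close>

lemma vec_power2_nth: "(x ^ 2) $ i = (x $ i) ^ 2"
  by (simp add: power2_eq_square)

lemma cdiv_nth: "(x \<oslash> y) $ i = x $ i / y $ i"
  by (simp add: cdiv_def)

lemma integral_diag_of: "1 \<bullet> (diag_of m *v z) = (\<Sum>i\<in>UNIV. m i * z $ i)"
  by (simp add: inner_vec_def diag_of_mult_vec)

lemma has_vector_derivative_nth:
  "(f has_vector_derivative f') F \<Longrightarrow> ((\<lambda>s. f s $ i) has_real_derivative f' $ i) F"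
  unfolding has_real_derivative_iff_has_vector_derivative
  by (rule bounded_linear.has_vector_derivative[OF bounded_linear_vec_nth])

lemma has_derivative_integral_diag_of:
  assumes "\<And>i. ((\<lambda>s. z s $ i) has_real_derivative z' i) (at t within T)"
  shows "((\<lambda>s. 1 \<bullet> (diag_of m *v z s)) has_real_derivative (\<Sum>i\<in>UNIV. m i * z' i)) (at t within T)"
  unfolding integral_diag_of by (intro DERIV_sum DERIV_cmult assms)

text \<open>The relaxation part is \<open>lambda / 6\<close> times
  \<open>eta^2/h - 2 eta + h\<close>, whose partial derivatives in \<open>h\<close> and
  \<open>eta\<close> are \<open>1 - r^2\<close> and \<open>2 (r - 1)\<close>. The products
  \<open>h ut\<close>, \<open>h vt\<close>, \<open>h wt\<close> are kept together because they are
  what the scheme determines.\<close>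

lemma sgn_energy_has_derivative:
  assumes h: "(h has_vector_derivative ht) (at t within T)"
    and u: "(u has_vector_derivative ut) (at t within T)"
    and v: "(v has_vector_derivative vt) (at t within T)"
    and w: "(w has_vector_derivative wt) (at t within T)"
    and eta: "(eta has_vector_derivative etat) (at t within T)"
    and h0: "h t $ i \<noteq> 0"
  defines "r \<equiv> eta t $ i / h t $ i"
  shows "((\<lambda>s. sgn_energy g lambda b (h s) (u s) (v s) (w s) (eta s) $ i) has_real_derivative
      ht $ i * (((u t $ i)^2 + (v t $ i)^2) / 2 + (w t $ i)^2 / 6 + g * (h t $ i + b $ i)
        + lambda / 6 * (1 - r^2))
      + u t $ i * (h t $ i * ut $ i) + v t $ i * (h t $ i * vt $ i) + w t $ i * (h t $ i * wt $ i) / 3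
      + lambda / 3 * (r - 1) * etat $ i) (at t within T)"
proof -
  note d = assms(1-5)[THEN has_vector_derivative_nth, of i]
  have eta_r: "eta t $ i = r * h t $ i"
    using h0 by (simp add: r_def)
  show ?thesis
    unfolding sgn_energy_def
    by (simp add: vec_power2_nth cdiv_nth, (rule derivative_eq_intros d refl h0 numeral_neq_zero)+)
      (use h0 in \<open>simp add: eta_r field_simps power2_eq_square\<close>)
qed

text \<open>With a diagonal norm, the boundary terms at a node are \<open>\<beta> i / m i\<close>
  and \<open>\<gamma> i / m i\<close> times the local fluxes \<open>h u\<close> and
  \<open>h v\<close>, exactly the corrections in the defects.\<close>

lemma sgn_mass_rate:
  assumes "sgn_mass_eq Dx Dy (diag_of m) (diag_of \<beta>) (diag_of \<gamma>) h u v ht" and m: "\<And>i. m i \<noteq> 0"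
  shows "ht $ i = - product_defect Dx (\<lambda>i. \<beta> i / m i) h u i - product_defect Dy (\<lambda>i. \<gamma> i / m i) h v i"
  using arg_cong[OF assms(1)[unfolded sgn_mass_eq_def], of "\<lambda>x. x $ i"]
  by (simp add: matrix_inv_diag_of m diag_of_mult_vec product_defect_def divide_inverse algebra_simps)

text \<open>The boundary terms in \<open>ht\<close>, multiplied by the energy derivative in
  \<open>h\<close>, supply those of all the pairs. The derivatives of \<open>eta\<close> and
  \<open>b\<close> in the momentum equations cancel against the \<open>eta\<close> equation, and the
  source of the \<open>w\<close> equation cancels against \<open>w\<close> in the \<open>eta\<close>
  equation.\<close>

lemma sgn_energy_rate:
  fixes h u v w eta b :: "real ^ 'n"
  defines "E \<equiv> eta^2 \<oslash> h"
  assumes mass: "ht $ i = - product_defect Dx p h u i - product_defect Dy q h v i"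
    and mx: "sgn_x_momentum_eq Dx Dy g lambda b h u v eta ut"
    and my: "sgn_y_momentum_eq Dx Dy g lambda b h u v eta vt"
    and we: "sgn_w_eq Dx Dy lambda h u v w eta wt"
    and ee: "sgn_eta_eq Dx Dy b u v w eta etat"
    and h0: "h $ i \<noteq> 0"
  defines "r \<equiv> eta $ i / h $ i"
  shows "ht $ i * (((u $ i)^2 + (v $ i)^2) / 2 + (w $ i)^2 / 6 + g * (h $ i + b $ i)
        + lambda / 6 * (1 - r^2))
      + u $ i * (h $ i * ut $ i) + v $ i * (h $ i * vt $ i) + w $ i * (h $ i * wt $ i) / 3
      + lambda / 3 * (r - 1) * etat $ i =
    - (g * product_defect Dx p (h * (h + b)) u i + 1/2 * product_defect Dx p (h * u) (u^2) i
       + 1/2 * product_defect Dx p (h * u * v) v i + 1/6 * product_defect Dx p (h * u * w) w i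
       + lambda / 6 * product_defect Dx p h u i - lambda / 6 * product_defect Dx p E u i
       + g * product_defect Dy q (h * (h + b)) v i + 1/2 * product_defect Dy q (h * v) (v^2) i
       + 1/2 * product_defect Dy q (h * u * v) u i + 1/6 * product_defect Dy q (h * v * w) w i
       + lambda / 6 * product_defect Dy q h v i - lambda / 6 * product_defect Dy q E v i)"
proof -
  \<comment> \<open>with \<open>r = eta/h\<close> eliminating \<open>eta\<close>, all quotients disappear and a polynomial identity remains\<close>
  have r: "eta $ i = r * h $ i" "(eta^2 \<oslash> h^2) $ i = r^2" "(eta \<oslash> h) $ i = r" "E $ i = r^2 * h $ i"
    using h0 by (simp_all add: r_def E_def cdiv_nth vec_power2_nth power_divide power2_eq_square)
  \<comment> \<open>Only nodal values are expanded; products under \<open>Dx\<close> and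
    \<open>Dy\<close> stay whole, and folding \<open>E\<close> gives its derivative one fixed
    form.\<close>
  note c = vec_power2_nth r product_defect_def E_def[symmetric]
  note mx' = arg_cong[OF mx[unfolded sgn_x_momentum_eq_def], of "\<lambda>x. x $ i", simplified c, simplified, simplified c]
  note my' = arg_cong[OF my[unfolded sgn_y_momentum_eq_def], of "\<lambda>x. x $ i", simplified c, simplified, simplified c]
  note we' = arg_cong[OF we[unfolded sgn_w_eq_def], of "\<lambda>x. x $ i", simplified c, simplified, simplified c]
  note ee' = arg_cong[OF ee[unfolded sgn_eta_eq_def], of "\<lambda>x. x $ i", simplified c, simplified, simplified c]
  show ?thesis
    unfolding mass product_defect_def
    \<comment> \<open>The multipliers are the coefficients of \<open>h ut\<close>,
      \<open>h vt\<close>, \<open>h wt\<close> and \<open>etat\<close> in the energy rate. Once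
      everything is expanded into monomials, the claim is a linear consequence of the four scaled
      equations.\<close>
    using arg_cong[OF mx', of "\<lambda>z. u $ i * z"] arg_cong[OF my', of "\<lambda>z. v $ i * z"]
      arg_cong[OF we', of "\<lambda>z. w $ i / 3 * z"] arg_cong[OF ee', of "\<lambda>z. lambda / 3 * (r - 1) * z"]
    by (simp only: c vector_mult_component vector_add_component)
      (simp only: ring_distribs times_divide_eq_left times_divide_eq_right divide_divide_eq_left
        mult_1 mult_1_right add_divide_distrib diff_divide_distrib power2_eq_square mult_ac
        mult_zero_left mult_zero_right mult_minus_left mult_minus_right minus_mult_minus)
qed

text \<open>Summing the nodal rates with the weights \<open>m\<close> annihilates every product
  defect, in mass and energy alike. The tensor-product construction below supplies the diagonal
  matrices and both SBP identities.\<close>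

lemma diag_norm_conservation:
  fixes Dx Dy :: "real ^ 'n ^ 'n"
  assumes m: "\<And>i. m i \<noteq> 0"
    and sbp_x: "diag_of m ** Dx + transpose Dx ** diag_of m = diag_of \<beta>"
    and sbp_y: "diag_of m ** Dy + transpose Dy ** diag_of m = diag_of \<gamma>"
    and sol: "sgn_solution Dx Dy (diag_of m) (diag_of \<beta>) (diag_of \<gamma>) g lambda b T h u v w eta"
    and t: "t \<in> T"
  shows "((\<lambda>s. 1 \<bullet> (diag_of m *v h s)) has_real_derivative 0) (at t within T)"
    and "((\<lambda>s. 1 \<bullet> (diag_of m *v sgn_energy g lambda b (h s) (u s) (v s) (w s) (eta s)))
        has_real_derivative 0) (at t within T)"
proof -
  obtain ht ut vt wt etat where d:
      "(h has_vector_derivative ht) (at t within T)"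
      "(u has_vector_derivative ut) (at t within T)"
      "(v has_vector_derivative vt) (at t within T)"
      "(w has_vector_derivative wt) (at t within T)"
      "(eta has_vector_derivative etat) (at t within T)"
    and mass: "sgn_mass_eq Dx Dy (diag_of m) (diag_of \<beta>) (diag_of \<gamma>) (h t) (u t) (v t) ht"
    and eqs: "sgn_x_momentum_eq Dx Dy g lambda b (h t) (u t) (v t) (eta t) ut"
      "sgn_y_momentum_eq Dx Dy g lambda b (h t) (u t) (v t) (eta t) vt"
      "sgn_w_eq Dx Dy lambda (h t) (u t) (v t) (w t) (eta t) wt"
      "sgn_eta_eq Dx Dy b (u t) (v t) (w t) (eta t) etat"
    and h_pos: "\<And>i. h t $ i > 0"
    using sol t unfolding sgn_solution_def by blast
  have h0: "h t $ i \<noteq> 0" for i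
    using h_pos[of i] by simp
  note rate = sgn_mass_rate[OF mass m]
  note cancel = sum_product_defect[OF sbp_x m] sum_product_defect[OF sbp_y m]
  have scaled: "(\<Sum>i\<in>UNIV. m i * (c * f i)) = 0" if "(\<Sum>i\<in>UNIV. m i * f i) = 0" for c f
    using that by (simp add: mult.left_commute flip: sum_distrib_left)
  have "(\<Sum>i\<in>UNIV. m i * ht $ i) = 0"
    by (simp add: rate ring_distribs sum.distrib sum_subtractf sum_negf cancel)
  then show "((\<lambda>s. 1 \<bullet> (diag_of m *v h s)) has_real_derivative 0) (at t within T)"
    using has_derivative_integral_diag_of[OF has_vector_derivative_nth[OF d(1)], of m] by simp
  show "((\<lambda>s. 1 \<bullet> (diag_of m *v sgn_energy g lambda b (h s) (u s) (v s) (w s) (eta s)))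
      has_real_derivative 0) (at t within T)"
    \<comment> \<open>The inner \<open>DERIV_cong\<close> rewrites each nodal energy rate as a
      combination of defects; the outer one leaves the vanishing of its weighted sum.\<close>
    by (rule DERIV_cong[OF has_derivative_integral_diag_of[OF DERIV_cong
            [OF sgn_energy_has_derivative[OF d h0] sgn_energy_rate[OF rate eqs h0]]]])
      (simp only: ring_distribs sum.distrib sum_subtractf sum_negf mult_minus_right
        cancel scaled[OF cancel(1)] scaled[OF cancel(2)] add_0 diff_0 minus_zero)
qed

theorem theorem4p3:
  fixes xmin xmax ymin ymax :: real
    and x :: "real ^ 'nx::{finite,linorder}" and y :: "real ^ 'ny::{finite,linorder}"
    and D1x Mx :: "real ^ 'nx::{finite,linorder} ^ 'nx::{finite,linorder}" and D1y My :: "real ^ 'ny::{finite,linorder} ^ 'ny::{finite,linorder}"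
    and R :: "real ^ ('nx \<times> 'ny) ^ ('nx, 'ny) bnode"
    and B Nx Ny :: "real ^ ('nx, 'ny) bnode ^ ('nx, 'ny) bnode"
    and Dx Dy M :: "real ^ ('nx \<times> 'ny) ^ ('nx \<times> 'ny)"
    and g lambda :: real and b :: "real ^ ('nx \<times> 'ny)"
    and T :: "real set" and h u v w eta :: "real \<Rightarrow> real ^ ('nx \<times> 'ny)"
  assumes "SBP_operator xmin xmax x D1x Mx" and "diagonal Mx"
    and "SBP_operator ymin ymax y D1y My" and "diagonal My"
    and "Dx = D1x \<otimes>\<^sub>K mat 1" and "Dy = mat 1 \<otimes>\<^sub>K D1y" and "M = Mx \<otimes>\<^sub>K My"
    and "R = restr_mat" and "B = bmass_mat Mx My" and "Nx = normal_x_mat" and "Ny = normal_y_mat"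
    and "is_interval T"
    and "sgn_solution Dx Dy M (transpose R ** B ** Nx ** R) (transpose R ** B ** Ny ** R)
           g lambda b T h u v w eta"
  shows "(\<forall>t\<in>T. ((\<lambda>s. 1 \<bullet> (M *v h s)) has_real_derivative 0) (at t within T)) \<and>
         (\<forall>t\<in>T. ((\<lambda>s. 1 \<bullet> (M *v sgn_energy g lambda b (h s) (u s) (v s) (w s) (eta s)))
             has_real_derivative 0) (at t within T))"
proof -
  define mx my where "mx = (\<lambda>i. Mx $ i $ i)" and "my = (\<lambda>j. My $ j $ j)"
  note sbp = assms(1,3)[unfolded SBP_operator_def]
  have Mx: "Mx = diag_of mx" and My: "My = diag_of my"
    using assms(2,4) by (simp_all add: mx_def my_def diagonal_eq_diag_of)
  have pos: "mx i > 0" "my j > 0" for i j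
    using sbp by (simp_all add: mx_def my_def sym_pos_def_diag_pos)
  define m where "m = (\<lambda>p. mx (fst p) * my (snd p))"
  have M: "M = diag_of m"
    by (simp add: assms(7) Mx My kron_diag_of m_def)
  have m0: "m p \<noteq> 0" for p
    using pos by (simp add: m_def less_imp_neq[symmetric])
  have BNx: "transpose R ** B ** Nx ** R = diag_of (\<lambda>p. end_sign (fst p) * my (snd p))"
    by (simp add: assms(8-10) boundary_operator_x my_def)
  have BNy: "transpose R ** B ** Ny ** R = diag_of (\<lambda>p. mx (fst p) * end_sign (snd p))"
    by (simp add: assms(8,9,11) boundary_operator_y mx_def)
  \<comment> \<open>Tensoring the one-dimensional boundary matrix with \<open>My\<close> yields the
    same diagonal matrix as the edge-by-edge operator in \<open>BNx\<close>.\<close>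
  have sbp_x: "diag_of m ** Dx + transpose Dx ** diag_of m = diag_of (\<lambda>p. end_sign (fst p) * my (snd p))"
    using sbp_kron_x[of Mx D1x "diag_of end_sign" My] sbp by (simp add: outer_end_points assms(5,7) My kron_diag_of flip: M)
  have sbp_y: "diag_of m ** Dy + transpose Dy ** diag_of m = diag_of (\<lambda>p. mx (fst p) * end_sign (snd p))"
    using sbp_kron_y[of My D1y "diag_of end_sign" Mx] sbp by (simp add: outer_end_points assms(6,7) Mx kron_diag_of flip: M)
  show ?thesis
    using diag_norm_conservation[OF m0 sbp_x sbp_y, of g lambda b T h u v w eta] assms(13)
    unfolding BNx BNy M by blast
qed

end
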